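(* Let $m<n$ be positive integers and let $T$ be a real $(n\times m)$-matrix of full rank $m$. Let $F:\mathbb{R}^n\to\mathbb{R}$ be a function with integrable Fourier transform $\widehat{F}$, let $f:\mathbb{R}^m\to\mathbb{R}$, $f(x)=F(Tx)$, and let $\mu$ be a positive constant. Let $$U(y)=\left(\frac{1}{\sqrt{2\pi}}\right)^n\int_{\mathbb{R}^n}\frac{1}{\|T^t\omega\|^2+\mu}\,\widehat{F}(\omega)\,e^{i\omega\cdot y}\,d\omega .$$ Then the trace $u:\mathbb{R}^m\to\mathbb{R}$, $u(x)=U(Tx)$, is twice continuously differentiable and is the only solution of the equation $$-\Delta u+\mu u=f$$ on $\mathbb{R}^m$ whose values tend uniformly to zero as $\|x\|$ goes to infinity. Provided the function $$\omega\mapsto\frac{1}{\|T^t\omega\|^2}\,\widehat{F}(\omega)$$ is integrable over $\mathbb{R}^n$, the same holds in the limit case $\mu=0$.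
   Context: $\|\cdot\|$ is the Euclidean norm and $T^t$ is the transpose of $T$. A function $F:\mathbb{R}^n\to\mathbb{R}$ is said to possess an integrable Fourier transform if there is a (then unique) $\widehat{F}\in L_1(\mathbb{R}^n)$ with $F(y)=(2\pi)^{-n/2}\int\widehat{F}(\omega)e^{i\omega\cdot y}\,d\omega$ for all $y\in\mathbb{R}^n$. Solutions are classical (twice continuously differentiable) solutions. *)

theory Defs
  imports "HOL-Analysis.Analysis"
begin

text \<open>\<^term>\<open>Fhat\<close> is a representative of the Fourier transform of \<^term>\<open>F\<close>, which is
  determined only up to null sets. The measure \<^term>\<open>lebesgue\<close> (rather than \<^term>\<open>lborel\<close>)
  admits arbitrary Lebesgue measurable representatives.\<close>

definition integrable_fourier_transform ::
    "(real^'n \<Rightarrow> real) \<Rightarrow> (real^'n \<Rightarrow> complex) \<Rightarrow> bool" where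
  "integrable_fourier_transform F Fhat \<longleftrightarrow>
     integrable lebesgue Fhat \<and>
     (\<forall>y. complex_of_real (F y) =
        complex_of_real ((2 * pi) powr (- (real CARD('n) / 2))) *
        (\<integral>\<omega>. Fhat \<omega> * exp (\<i> * complex_of_real (\<omega> \<bullet> y)) \<partial>lebesgue))"

text \<open>For \<open>\<mu> = 0\<close> the factor is \<open>0\<close>, by the convention on division, on the kernel of the
  transposed matrix. For the matrices of interest this kernel is a null set.\<close>

definition fourier_solution ::
    "real^'m^'n \<Rightarrow> real \<Rightarrow> (real^'n \<Rightarrow> complex) \<Rightarrow> real^'n \<Rightarrow> complex" where
  "fourier_solution T \<mu> Fhat y =
     complex_of_real ((1 / sqrt (2 * pi)) ^ CARD('n)) *
     (\<integral>\<omega>. complex_of_real (1 / ((norm (transpose T *v \<omega>))\<^sup>2 + \<mu>)) * Fhat \<omega> *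
          exp (\<i> * complex_of_real (\<omega> \<bullet> y)) \<partial>lebesgue)"

definition has_partial :: "'m \<Rightarrow> (real^'m \<Rightarrow> real) \<Rightarrow> real^'m \<Rightarrow> bool" where
  "has_partial i u x \<longleftrightarrow> (\<lambda>t. u (x + t *\<^sub>R axis i 1)) differentiable (at 0)"

definition partial :: "'m \<Rightarrow> (real^'m \<Rightarrow> real) \<Rightarrow> real^'m \<Rightarrow> real" where
  "partial i u x = deriv (\<lambda>t. u (x + t *\<^sub>R axis i 1)) 0"

definition twice_continuously_differentiable :: "(real^'m \<Rightarrow> real) \<Rightarrow> bool" where
  "twice_continuously_differentiable u \<longleftrightarrow>
     continuous_on UNIV u \<and>
     (\<forall>i. (\<forall>x. has_partial i u x) \<and> continuous_on UNIV (partial i u)) \<and>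
     (\<forall>i j. (\<forall>x. has_partial j (partial i u) x) \<and>
            continuous_on UNIV (partial j (partial i u)))"

definition laplacian :: "(real^'m \<Rightarrow> real) \<Rightarrow> real^'m \<Rightarrow> real" where
  "laplacian u x = (\<Sum>i\<in>UNIV. partial i (partial i u) x)"

definition vanishing_classical_solution ::
    "real \<Rightarrow> (real^'m \<Rightarrow> real) \<Rightarrow> (real^'m \<Rightarrow> real) \<Rightarrow> bool" where
  "vanishing_classical_solution \<mu> f u \<longleftrightarrow>
     twice_continuously_differentiable u \<and>
     (\<forall>x. - laplacian u x + \<mu> * u x = f x) \<and>
     (u \<longlongrightarrow> 0) at_infinity"

end

theory Submission imports Defs begin

text \<open>The trace is \<open>x \<mapsto> \<integral> H \<omega> exp (\<i> (S \<omega> \<bullet> x)) d\<omega>\<close> with \<open>S \<omega> = T\<^sup>t \<omega>\<close>, where both \<open>H\<close> and \<open>\<parallel>S \<omega>\<parallel>\<^sup>2 H\<close>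
  are integrable. Differentiating under the integral sign gives the equation, and the
  Riemann-Lebesgue lemma together with the injectivity of \<open>T\<close> gives the decay. Uniqueness is a
  maximum principle. It also shows that the trace is real-valued: its imaginary part is a
  vanishing solution of the homogeneous equation.\<close>

text \<open>Only integrability of \<open>Fhat\<close> is given, so two derivatives must be gained
  from the kernel. Differentiating the trace brings down components of \<open>S \<omega>\<close>,
  never of \<open>\<omega>\<close> itself, and
  \<open>(norm (S \<omega>))^2 / ((norm (S \<omega>))^2 + \<mu>)\<close> is at most 1: the second
  moment of \<open>H\<close> is dominated by a multiple of \<open>Fhat\<close>. Transversally to the
  range of \<open>T\<close> nothing of the kind is available, which is why the equation is derived
  for the trace and not by restricting an equation on R^n. For the decay it is the other way round:
  \<open>S\<close> lowers the dimension and \<open>H\<close> is a density over R^n, so the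
  Riemann-Lebesgue lemma is applied on R^n and its conclusion is then restricted to the range of
  \<open>T\<close>. Reality of the trace could also be read off a Hermitian symmetry of
  \<open>Fhat\<close>, but that symmetry rests on uniqueness of the Fourier transform. The maximum
  principle replaces this argument.\<close>

section \<open>Maximum principle and uniqueness\<close>

lemma DERIV2_nonpos_at_max:
  fixes a b :: "real \<Rightarrow> real"
  assumes a: "\<And>t. (a has_real_derivative b t) (at t)"
    and b: "(b has_real_derivative c) (at 0)"
    and "\<epsilon> > 0" and max: "\<And>t. \<bar>t\<bar> < \<epsilon> \<Longrightarrow> a t \<le> a 0"
  shows "c \<le> 0"
proof (rule ccontr)
  assume "\<not> c \<le> 0"
  have "b 0 = 0"
    by (rule DERIV_local_max[OF a \<open>\<epsilon> > 0\<close>]) (use max in auto)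
  obtain d where d: "d > 0" "\<And>h. h > 0 \<Longrightarrow> h < d \<Longrightarrow> b 0 < b (0 + h)"
    using DERIV_pos_inc_right[OF b] \<open>\<not> c \<le> 0\<close> by auto
  define s where "s = min d \<epsilon> / 2"
  have s: "0 < s" "s < d" "s < \<epsilon>"
    using \<open>d > 0\<close> \<open>\<epsilon> > 0\<close> by (auto simp: s_def)
  \<comment> \<open>With \<open>c > 0\<close>, the derivative \<open>b\<close> vanishes at 0 and is
    positive just to the right of it, so \<open>a\<close> increases strictly there.\<close>
  have "a 0 < a s"
  proof (rule DERIV_pos_imp_increasing_open[OF \<open>0 < s\<close>])
    show "\<exists>y. (a has_real_derivative y) (at x) \<and> 0 < y" if "0 < x" "x < s" for x
      using a[of x] d(2)[of x] that s \<open>b 0 = 0\<close> by auto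
    show "continuous_on {0..s} a"
      by (rule DERIV_continuous_on[OF DERIV_subset[OF a]]) auto
  qed
  with max[of s] s show False by auto
qed

lemma norm_add_axis_sq:
  fixes x :: "real^'m"
  shows "(norm (x + t *\<^sub>R axis i 1))\<^sup>2 = (norm x)\<^sup>2 + 2 * t * x $ i + t\<^sup>2"
  unfolding power2_norm_eq_inner
  by (simp add: inner_add_left inner_add_right inner_axis_axis
      inner_axis inner_commute[of "axis i _" x] algebra_simps power2_eq_square)

text \<open>For \<open>\<mu> = 0\<close> the maximum of \<open>w\<close> itself yields no contradiction, hence the perturbation
  by a small multiple of \<open>\<parallel>x\<parallel>\<^sup>2\<close>.\<close>

lemma subsolution_nonpos:
  fixes w :: "real^'m \<Rightarrow> real"
  assumes "\<mu> \<ge> 0" and cont: "continuous_on UNIV w"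
    and p: "\<And>i x t. ((\<lambda>s. w (x + s *\<^sub>R axis i 1)) has_real_derivative p i (x + t *\<^sub>R axis i 1)) (at t)"
    and q: "\<And>i x. ((\<lambda>s. p i (x + s *\<^sub>R axis i 1)) has_real_derivative q i x) (at 0)"
    and eq: "\<And>x. (\<Sum>i\<in>UNIV. q i x) = \<mu> * w x"
    and lim: "(w \<longlongrightarrow> 0) at_infinity"
  shows "w x0 \<le> 0"
proof (rule ccontr)
  assume "\<not> w x0 \<le> 0"
  hence pos: "w x0 > 0" by simp
  have "\<forall>\<^sub>F x in at_infinity. w x < w x0 / 2"
    using order_tendstoD(2)[OF lim, of "w x0 / 2"] pos by simp
  then obtain R0 where R0: "\<And>x. norm x \<ge> R0 \<Longrightarrow> w x < w x0 / 2"
    by (auto simp: eventually_at_infinity)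
  \<comment> \<open>The ball must contain \<open>x0\<close>, and on its boundary \<open>w\<close>
    must already be below \<open>w x0 / 2\<close>.\<close>
  define R where "R = max (max R0 1) (norm x0 + 1)"
  have R: "R > 0" "R \<ge> R0" "R > norm x0" by (auto simp: R_def)
  \<comment> \<open>The perturbation then adds at most \<open>w x0 / 4\<close> on the ball. A
    maximum point of \<open>z\<close> keeps \<open>w\<close> at or above three quarters of
    \<open>w x0\<close>, more than the half that is possible near the boundary, so it is
    interior.\<close>
  define \<epsilon> where "\<epsilon> = w x0 / (4 * R\<^sup>2)"
  have \<epsilon>: "\<epsilon> > 0" "\<epsilon> * R\<^sup>2 = w x0 / 4"
    using pos R by (auto simp: \<epsilon>_def)
  define z where "z x = w x + \<epsilon> * (norm x)\<^sup>2" for x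
  have "continuous_on (cball 0 R) z"
    unfolding z_def by (intro continuous_intros continuous_on_subset[OF cont]) auto
  then obtain y where y: "y \<in> cball 0 R" "\<And>x. x \<in> cball 0 R \<Longrightarrow> z x \<le> z y"
    using continuous_attains_sup[of "cball 0 R" z] R by auto
  have "z x0 \<le> z y" using y(2)[of x0] R by auto
  moreover have "w x0 \<le> z x0" using \<epsilon> by (simp add: z_def)
  moreover have "\<epsilon> * (norm y)\<^sup>2 \<le> \<epsilon> * R\<^sup>2"
    using y(1) \<epsilon> by (intro mult_left_mono power_mono) auto
  ultimately have wy: "w y \<ge> w x0 * 3 / 4" using \<epsilon> unfolding z_def[of y] by linarith
  hence "norm y < R0" using R0[of y] pos by (cases "norm y < R0") auto
  hence ny: "norm y < R" using R by simp
  \<comment> \<open>Second derivative test for \<open>z\<close> along each axis. Summed over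
    \<open>i\<close> it makes \<open>\<mu> * w y\<close> strictly negative even when
    \<open>\<mu> = 0\<close>, against \<open>w y > 0\<close>.\<close>
  have "q i y + 2 * \<epsilon> \<le> 0" for i
  proof (rule DERIV2_nonpos_at_max)
    show "((\<lambda>s. z (y + s *\<^sub>R axis i 1)) has_real_derivative
        p i (y + t *\<^sub>R axis i 1) + \<epsilon> * (2 * y $ i + 2 * t)) (at t)" for t
      unfolding z_def norm_add_axis_sq
      by (rule derivative_eq_intros p refl | simp)+
    show "((\<lambda>t. p i (y + t *\<^sub>R axis i 1) + \<epsilon> * (2 * y $ i + 2 * t))
        has_real_derivative q i y + 2 * \<epsilon>) (at 0)"
      by (rule derivative_eq_intros q refl | simp)+
    show "0 < R - norm y" using ny by simp
    show "z (y + t *\<^sub>R axis i 1) \<le> z (y + 0 *\<^sub>R axis i 1)" if "\<bar>t\<bar> < R - norm y" for t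
      using norm_triangle_ineq[of y "t *\<^sub>R axis i 1"] that
      by (auto intro!: y(2) simp: norm_axis_1)
  qed
  hence "(\<Sum>i\<in>UNIV. q i y) \<le> (\<Sum>i::'m\<in>UNIV. - 2 * \<epsilon>)"
    by (intro sum_mono) (smt (verit))
  also have "\<dots> < 0" using \<epsilon> by simp
  finally have "\<mu> * w y < 0" by (simp add: eq)
  moreover have "w y > 0" using wy pos by linarith
  ultimately show False using \<open>\<mu> \<ge> 0\<close> by (simp add: mult_less_0_iff)
qed

text \<open>\<open>partial\<close> is a derivative at parameter 0 only; moving the base point along
  the axis provides the derivative on the whole line, as required by the one-dimensional maximum
  test.\<close>

lemma has_partialD:
  assumes "\<And>x. has_partial i u x"
  shows "((\<lambda>s. u (x + s *\<^sub>R axis i 1)) has_real_derivative partial i u (x + t *\<^sub>R axis i 1)) (at t)"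
proof -
  let ?y = "x + t *\<^sub>R axis i 1"
  have "((\<lambda>s. u (?y + s *\<^sub>R axis i 1)) has_real_derivative partial i u ?y) (at 0)"
    using assms[of ?y] unfolding has_partial_def partial_def
    by (simp add: DERIV_deriv_iff_real_differentiable)
  hence "((\<lambda>s. u (x + s *\<^sub>R axis i 1)) has_real_derivative partial i u ?y) (at (0 + t))"
    by (subst DERIV_shift) (simp add: scaleR_add_left add.assoc add.commute add.left_commute)
  thus ?thesis by simp
qed

text \<open>The datum \<open>f\<close> cancels in \<open>v - u\<close>, which therefore falls under
  the maximum principle. Exchanging the two solutions gives the reverse inequality.\<close>

lemma vanishing_classical_solution_le:
  assumes "\<mu> \<ge> 0" "vanishing_classical_solution \<mu> f u" "vanishing_classical_solution \<mu> f v"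
  shows "v x \<le> u x"
proof -
  note u = assms(2)[unfolded vanishing_classical_solution_def twice_continuously_differentiable_def]
  note v = assms(3)[unfolded vanishing_classical_solution_def twice_continuously_differentiable_def]
  have "v x - u x \<le> 0"
  proof (rule subsolution_nonpos[of \<mu> "\<lambda>x. v x - u x"
        "\<lambda>i x. partial i v x - partial i u x"
        "\<lambda>i x. partial i (partial i v) x - partial i (partial i u) x"])
    show "continuous_on UNIV (\<lambda>x. v x - u x)" using u v by (intro continuous_intros) auto
    show "((\<lambda>s. v (x + s *\<^sub>R axis i 1) - u (x + s *\<^sub>R axis i 1)) has_real_derivative
        partial i v (x + t *\<^sub>R axis i 1) - partial i u (x + t *\<^sub>R axis i 1)) (at t)" for i x t
      using u v by (intro DERIV_diff has_partialD) auto
    have "((\<lambda>s. partial i v (x + s *\<^sub>R axis i 1) - partial i u (x + s *\<^sub>R axis i 1))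
        has_real_derivative partial i (partial i v) (x + 0 *\<^sub>R axis i 1)
          - partial i (partial i u) (x + 0 *\<^sub>R axis i 1)) (at 0)" for i x
      using u v by (intro DERIV_diff has_partialD) auto
    thus "((\<lambda>s. partial i v (x + s *\<^sub>R axis i 1) - partial i u (x + s *\<^sub>R axis i 1))
        has_real_derivative partial i (partial i v) x - partial i (partial i u) x) (at 0)" for i x
      by simp
    have "laplacian v x - laplacian u x = \<mu> * (v x - u x)" for x
      using u v by (smt (verit) right_diff_distrib)
    thus "(\<Sum>i\<in>UNIV. partial i (partial i v) x - partial i (partial i u) x) = \<mu> * (v x - u x)" for x
      by (simp add: laplacian_def sum_subtractf)
    show "((\<lambda>x. v x - u x) \<longlongrightarrow> 0) at_infinity"
      using tendsto_diff[of v 0 at_infinity u 0] u v by auto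
  qed (use \<open>\<mu> \<ge> 0\<close> in auto)
  thus ?thesis by simp
qed

lemma vanishing_classical_solution_unique:
  assumes "\<mu> \<ge> 0" "vanishing_classical_solution \<mu> f u" "vanishing_classical_solution \<mu> f v"
  shows "v = u"
  using vanishing_classical_solution_le[OF assms] vanishing_classical_solution_le[OF assms(1,3,2)]
  by (intro ext antisym)

section \<open>Oscillatory integrals: continuity and differentiation\<close>

text \<open>This is the unnormalized inverse Fourier transform of the image under \<open>S\<close>
  of the complex measure with density \<open>H\<close>. Keeping \<open>S\<close> general covers both
  the trace (\<open>S\<close> the transposed matrix) and the integral over R^n (\<open>S\<close> the
  identity).\<close>

definition oscillatory_integral ::
    "'a measure \<Rightarrow> ('a \<Rightarrow> 'b::euclidean_space) \<Rightarrow> ('a \<Rightarrow> complex) \<Rightarrow> 'b \<Rightarrow> complex" where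
  "oscillatory_integral M S H x = (\<integral>\<omega>. H \<omega> * exp (\<i> * complex_of_real (S \<omega> \<bullet> x)) \<partial>M)"

lemma integrable_oscillatory:
  fixes S :: "'a \<Rightarrow> 'b::euclidean_space"
  assumes "integrable M H" "S \<in> borel_measurable M"
  shows "integrable M (\<lambda>\<omega>. H \<omega> * exp (\<i> * complex_of_real (S \<omega> \<bullet> x)))"
proof (rule Bochner_Integration.integrable_bound[OF assms(1)])
  have [measurable]: "H \<in> borel_measurable M" "S \<in> borel_measurable M" using assms by auto
  have [measurable]: "exp \<in> borel_measurable (borel :: complex measure)"
    by (intro borel_measurable_continuous_onI continuous_intros)
  show "(\<lambda>\<omega>. H \<omega> * exp (\<i> * complex_of_real (S \<omega> \<bullet> x))) \<in> borel_measurable M"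
    by measurable
qed (simp add: norm_mult)

lemma norm_oscillatory_integral_le:
  "norm (oscillatory_integral M S H x) \<le> (\<integral>\<omega>. norm (H \<omega>) \<partial>M)"
  unfolding oscillatory_integral_def
  using integral_norm_bound[of M "\<lambda>\<omega>. H \<omega> * exp (\<i> * complex_of_real (S \<omega> \<bullet> x))"]
  by (simp add: norm_mult)

lemma continuous_oscillatory_integral:
  fixes S :: "'a \<Rightarrow> 'b::euclidean_space"
  assumes "integrable M H" "S \<in> borel_measurable M"
  shows "continuous_on UNIV (oscillatory_integral M S H)"
proof -
  have "isCont (oscillatory_integral M S H) x" for x
    unfolding continuous_at_sequentially
  proof (intro allI impI)
    fix y :: "nat \<Rightarrow> 'b" assume y: "y \<longlonglongrightarrow> x"
    show "(oscillatory_integral M S H \<circ> y) \<longlonglongrightarrow> oscillatory_integral M S H x"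
      unfolding oscillatory_integral_def o_def
    proof (rule integral_dominated_convergence[where w = "\<lambda>\<omega>. norm (H \<omega>)"])
      show "AE \<omega> in M. (\<lambda>i. H \<omega> * exp (\<i> * complex_of_real (S \<omega> \<bullet> y i)))
          \<longlonglongrightarrow> H \<omega> * exp (\<i> * complex_of_real (S \<omega> \<bullet> x))"
        by (intro AE_I2 tendsto_intros y)
    qed (use assms integrable_oscillatory[OF assms] in
        \<open>auto intro!: borel_measurable_integrable simp: norm_mult\<close>)
  qed
  thus ?thesis by (simp add: continuous_on_eq_continuous_at)
qed

lemma exp_i_difference_quotient:
  "((\<lambda>t. (exp (\<i> * complex_of_real (a * t)) - 1) / complex_of_real t) \<longlongrightarrow> \<i> * complex_of_real a) (at 0)"
proof -
  have "((\<lambda>z. exp (\<i> * complex_of_real a * z)) has_field_derivative \<i> * complex_of_real a) (at 0)"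
    by (rule derivative_eq_intros refl | simp)+
  hence "((\<lambda>z. (exp (\<i> * complex_of_real a * z) - 1) / z) \<longlongrightarrow> \<i> * complex_of_real a) (at 0)"
    by (simp add: DERIV_def)
  moreover have "filterlim complex_of_real (at 0) (at 0)"
    unfolding filterlim_at by (auto intro!: tendsto_eq_intros simp: eventually_at_filter)
  ultimately show ?thesis
    by (auto dest: filterlim_compose simp: mult.assoc)
qed

text \<open>A chord of the unit circle is no longer than its arc: \<open>dist_exp_i_1\<close>
  expresses the chord through a sine. The bound is uniform in \<open>t\<close>, as dominated
  convergence demands; at \<open>t = 0\<close> the quotient is 0 by convention.\<close>

lemma norm_exp_i_difference_quotient_le:
  "norm ((exp (\<i> * complex_of_real (a * t)) - 1) / complex_of_real t) \<le> \<bar>a\<bar>"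
proof (cases "t = 0")
  case False
  have "norm (exp (\<i> * complex_of_real (a * t)) - 1) \<le> \<bar>a * t\<bar>"
    using abs_sin_x_le_abs_x[of "a * t / 2"] by (subst dist_exp_i_1) simp
  thus ?thesis using False by (simp add: norm_divide abs_mult divide_simps)
qed simp

lemma oscillatory_integral_difference_quotient:
  fixes S :: "'a \<Rightarrow> real^'m"
  assumes H: "integrable M H" and S: "S \<in> borel_measurable M"
    and H': "integrable M (\<lambda>\<omega>. \<i> * complex_of_real (S \<omega> $ i) * H \<omega>)"
  shows "((\<lambda>t. (oscillatory_integral M S H (x + t *\<^sub>R axis i 1) - oscillatory_integral M S H x)
      / complex_of_real t) \<longlongrightarrow>
      oscillatory_integral M S (\<lambda>\<omega>. \<i> * complex_of_real (S \<omega> $ i) * H \<omega>) x) (at 0)"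
  unfolding tendsto_at_iff_sequentially
proof (intro allI impI)
  fix r :: "nat \<Rightarrow> real" assume r: "\<forall>i. r i \<in> UNIV - {0}" "r \<longlonglongrightarrow> 0"
  let ?e = "\<lambda>x \<omega>. exp (\<i> * complex_of_real (S \<omega> \<bullet> x))"
  \<comment> \<open>A shift along axis \<open>i\<close> multiplies the exponential by a factor that
    depends only on component \<open>i\<close> of \<open>S \<omega>\<close>. All dependence on
    \<open>n\<close> is thereby confined to \<open>?Q\<close>.\<close>
  let ?Q = "\<lambda>n \<omega>. (exp (\<i> * complex_of_real (S \<omega> $ i * r n)) - 1) / complex_of_real (r n)"
  have eq: "((\<lambda>t. (oscillatory_integral M S H (x + t *\<^sub>R axis i 1) - oscillatory_integral M S H x)
      / complex_of_real t) \<circ> r) = (\<lambda>n. \<integral>\<omega>. ?Q n \<omega> * (H \<omega> * ?e x \<omega>) \<partial>M)"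
  proof
    fix n
    have *: "?Q n \<omega> * (H \<omega> * ?e x \<omega>) =
        (H \<omega> * ?e (x + r n *\<^sub>R axis i 1) \<omega> - H \<omega> * ?e x \<omega>) / complex_of_real (r n)" for \<omega>
      by (simp add: inner_add_right inner_axis distrib_left exp_add divide_simps algebra_simps)
    show "((\<lambda>t. (oscillatory_integral M S H (x + t *\<^sub>R axis i 1) - oscillatory_integral M S H x)
      / complex_of_real t) \<circ> r) n = (\<integral>\<omega>. ?Q n \<omega> * (H \<omega> * ?e x \<omega>) \<partial>M)"
      unfolding * o_def oscillatory_integral_def
      using integrable_oscillatory[OF H S] by simp
  qed
  have [measurable]: "H \<in> borel_measurable M" "S \<in> borel_measurable M" using assms by auto
  have [measurable]: "exp \<in> borel_measurable (borel :: complex measure)"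
    by (intro borel_measurable_continuous_onI continuous_intros)
  have [measurable]: "(\<lambda>\<omega>. S \<omega> $ i) \<in> borel_measurable M"
    by (rule borel_measurable_continuous_on[OF _ S]) (intro continuous_intros)
  show "((\<lambda>t. (oscillatory_integral M S H (x + t *\<^sub>R axis i 1) - oscillatory_integral M S H x)
      / complex_of_real t) \<circ> r) \<longlonglongrightarrow>
      oscillatory_integral M S (\<lambda>\<omega>. \<i> * complex_of_real (S \<omega> $ i) * H \<omega>) x"
    unfolding eq unfolding oscillatory_integral_def
  proof (rule integral_dominated_convergence[where w = "\<lambda>\<omega>. norm (\<i> * complex_of_real (S \<omega> $ i) * H \<omega>)"])
    show "(\<lambda>\<omega>. \<i> * complex_of_real (S \<omega> $ i) * H \<omega> * ?e x \<omega>) \<in> borel_measurable M"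
      by measurable
    show "(\<lambda>\<omega>. ?Q n \<omega> * (H \<omega> * ?e x \<omega>)) \<in> borel_measurable M" for n
      by measurable
    show "integrable M (\<lambda>\<omega>. norm (\<i> * complex_of_real (S \<omega> $ i) * H \<omega>))"
      using H' by (rule integrable_norm)
    show "AE \<omega> in M. (\<lambda>n. ?Q n \<omega> * (H \<omega> * ?e x \<omega>))
        \<longlonglongrightarrow> \<i> * complex_of_real (S \<omega> $ i) * H \<omega> * ?e x \<omega>"
    proof (rule AE_I2)
      fix \<omega>
      have "(\<lambda>n. ?Q n \<omega>) \<longlonglongrightarrow> \<i> * complex_of_real (S \<omega> $ i)"
        using exp_i_difference_quotient[of "S \<omega> $ i", unfolded tendsto_at_iff_sequentially] r
        by (auto simp: o_def)
      from tendsto_mult[OF this tendsto_const[of "H \<omega> * ?e x \<omega>"]]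
      show "(\<lambda>n. ?Q n \<omega> * (H \<omega> * ?e x \<omega>))
        \<longlonglongrightarrow> \<i> * complex_of_real (S \<omega> $ i) * H \<omega> * ?e x \<omega>"
        by (simp add: mult.assoc)
    qed
    show "AE \<omega> in M. norm (?Q n \<omega> * (H \<omega> * ?e x \<omega>)) \<le> norm (\<i> * complex_of_real (S \<omega> $ i) * H \<omega>)" for n
    proof (rule AE_I2)
      fix \<omega>
      have "norm (?Q n \<omega> * (H \<omega> * ?e x \<omega>)) = norm (?Q n \<omega>) * norm (H \<omega>)"
        by (simp only: norm_mult norm_exp_i_times mult_1_right)
      also have "\<dots> \<le> \<bar>S \<omega> $ i\<bar> * norm (H \<omega>)"
        by (intro mult_right_mono norm_exp_i_difference_quotient_le) simp
      finally show "norm (?Q n \<omega> * (H \<omega> * ?e x \<omega>)) \<le> norm (\<i> * complex_of_real (S \<omega> $ i) * H \<omega>)"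
        by (simp add: norm_mult)
    qed
  qed
qed

text \<open>\<open>partial\<close> is defined for real-valued functions, while the integral is
  complex. A real-linear \<open>L\<close> treats real and imaginary part at once.\<close>

lemma oscillatory_integral_partial:
  fixes S :: "'a \<Rightarrow> real^'m" and L :: "complex \<Rightarrow> real"
  assumes H: "integrable M H" and S: "S \<in> borel_measurable M"
    and H': "integrable M (\<lambda>\<omega>. \<i> * complex_of_real (S \<omega> $ i) * H \<omega>)"
    and L: "bounded_linear L"
  shows "has_partial i (\<lambda>x. L (oscillatory_integral M S H x)) x"
    and "partial i (\<lambda>x. L (oscillatory_integral M S H x)) =
      (\<lambda>x. L (oscillatory_integral M S (\<lambda>\<omega>. \<i> * complex_of_real (S \<omega> $ i) * H \<omega>) x))"
proof -
  interpret bounded_linear L by fact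
  have *: "((\<lambda>t. L (oscillatory_integral M S H (x + t *\<^sub>R axis i 1))) has_real_derivative
      L (oscillatory_integral M S (\<lambda>\<omega>. \<i> * complex_of_real (S \<omega> $ i) * H \<omega>) x)) (at 0)" for x
  proof -
    have "L (z / complex_of_real t) = L z / t" for z t
      using scaleR[of "1 / t" z] by (simp add: scaleR_conv_of_real divide_inverse mult.commute)
    thus ?thesis
      using tendsto[OF oscillatory_integral_difference_quotient[OF H S H', of x]]
      by (simp add: DERIV_def diff)
  qed
  show "has_partial i (\<lambda>x. L (oscillatory_integral M S H x)) x"
    unfolding has_partial_def using * real_differentiable_def by blast
  show "partial i (\<lambda>x. L (oscillatory_integral M S H x)) =
      (\<lambda>x. L (oscillatory_integral M S (\<lambda>\<omega>. \<i> * complex_of_real (S \<omega> $ i) * H \<omega>) x))"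
    unfolding partial_def using DERIV_imp_deriv[OF *] by auto
qed

text \<open>The second moment controls the first one, since \<open>\<bar>s\<bar> \<le> 1 + s\<^sup>2\<close>.\<close>

lemma oscillatory_integral_C2:
  fixes S :: "'a \<Rightarrow> real^'m" and L :: "complex \<Rightarrow> real"
  assumes H: "integrable M H" and S: "S \<in> borel_measurable M"
    and H2: "integrable M (\<lambda>\<omega>. complex_of_real ((norm (S \<omega>))\<^sup>2) * H \<omega>)"
    and L: "bounded_linear L"
  shows "twice_continuously_differentiable (\<lambda>x. L (oscillatory_integral M S H x))"
    and "laplacian (\<lambda>x. L (oscillatory_integral M S H x)) x =
      - L (oscillatory_integral M S (\<lambda>\<omega>. complex_of_real ((norm (S \<omega>))\<^sup>2) * H \<omega>) x)"
proof -
  interpret bounded_linear L by fact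
  let ?H1 = "\<lambda>i \<omega>. \<i> * complex_of_real (S \<omega> $ i) * H \<omega>"
  let ?H2 = "\<lambda>i j \<omega>. \<i> * complex_of_real (S \<omega> $ j) * (\<i> * complex_of_real (S \<omega> $ i) * H \<omega>)"
  have [measurable]: "H \<in> borel_measurable M" using H by auto
  have [measurable]: "(\<lambda>\<omega>. S \<omega> $ i) \<in> borel_measurable M" for i
    by (rule borel_measurable_continuous_on[OF _ S]) (intro continuous_intros)
  have int2: "integrable M (?H2 i j)" for i j
  proof (rule Bochner_Integration.integrable_bound[OF H2])
    have "\<bar>S \<omega> $ i\<bar> * \<bar>S \<omega> $ j\<bar> \<le> (norm (S \<omega>))\<^sup>2" for \<omega>
      unfolding power2_eq_square by (intro mult_mono component_le_norm_cart) auto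
    from mult_right_mono[OF this norm_ge_zero[of "H _"]]
    show "AE \<omega> in M. norm (?H2 i j \<omega>) \<le> norm (complex_of_real ((norm (S \<omega>))\<^sup>2) * H \<omega>)"
      by (intro AE_I2) (simp add: norm_mult norm_power mult_ac)
  qed measurable
  have int1: "integrable M (?H1 i)" for i
  proof (rule Bochner_Integration.integrable_bound[OF Bochner_Integration.integrable_add[OF
          integrable_norm[OF H] integrable_norm[OF H2]]])
    have "\<bar>S \<omega> $ i\<bar> \<le> 1 + (norm (S \<omega>))\<^sup>2" for \<omega>
      \<comment> \<open>Expanding the square \<open>(norm (S \<omega>) - 1)^2 \<ge> 0\<close> gives
        even twice the norm as a lower bound for \<open>1 + (norm (S \<omega>))^2\<close>.\<close>
      using component_le_norm_cart[of "S \<omega>" i] zero_le_power2[of "norm (S \<omega>) - 1"]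
        norm_ge_zero[of "S \<omega>"] unfolding power2_diff by simp
    from mult_right_mono[OF this norm_ge_zero[of "H _"]]
    show "AE \<omega> in M. norm (?H1 i \<omega>) \<le> norm (norm (H \<omega>) + norm (complex_of_real ((norm (S \<omega>))\<^sup>2) * H \<omega>))"
      by (intro AE_I2) (simp add: norm_mult norm_power distrib_right)
  qed measurable
  note 1 = oscillatory_integral_partial[OF H S int1 L]
  note 2 = oscillatory_integral_partial[OF int1 S int2 L]
  have c: "continuous_on UNIV (\<lambda>x. L (oscillatory_integral M S G x))" if "integrable M G" for G
    using that by (intro continuous_on continuous_oscillatory_integral S)
  show "twice_continuously_differentiable (\<lambda>x. L (oscillatory_integral M S H x))"
    unfolding twice_continuously_differentiable_def
    by (intro conjI allI) (simp_all only: 1 2 c[OF H] c[OF int1] c[OF int2])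
  \<comment> \<open>Every derivative contributes a factor \<open>\<i>\<close>; the two of them
    produce the sign, and the squared components add up to the squared norm.\<close>
  have "(\<Sum>i\<in>UNIV. ?H2 i i \<omega>) = - (complex_of_real ((norm (S \<omega>))\<^sup>2) * H \<omega>)" for \<omega>
  proof -
    have "?H2 i i \<omega> = - (complex_of_real (S \<omega> $ i * S \<omega> $ i) * H \<omega>)" for i
      by (simp add: mult_ac complex_i_mult_minus)
    thus ?thesis
      by (simp add: power2_norm_eq_inner inner_vec_def sum_negf sum_distrib_right)
  qed
  moreover have "(\<Sum>i\<in>UNIV. oscillatory_integral M S (?H2 i i) x) =
      oscillatory_integral M S (\<lambda>\<omega>. \<Sum>i\<in>UNIV. ?H2 i i \<omega>) x"
    unfolding oscillatory_integral_def sum_distrib_right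
    by (subst Bochner_Integration.integral_sum) (auto intro!: integrable_oscillatory int2 S)
  ultimately have "(\<Sum>i\<in>UNIV. oscillatory_integral M S (?H2 i i) x) =
      - oscillatory_integral M S (\<lambda>\<omega>. complex_of_real ((norm (S \<omega>))\<^sup>2) * H \<omega>) x"
    by (simp add: oscillatory_integral_def)
  thus "laplacian (\<lambda>x. L (oscillatory_integral M S H x)) x =
      - L (oscillatory_integral M S (\<lambda>\<omega>. complex_of_real ((norm (S \<omega>))\<^sup>2) * H \<omega>) x)"
    unfolding laplacian_def 1 2 by (simp add: sum[symmetric] neg)
qed

section \<open>The Riemann-Lebesgue lemma\<close>

abbreviation char_integral :: "('a::euclidean_space \<Rightarrow> complex) \<Rightarrow> 'a \<Rightarrow> complex" where
  "char_integral \<equiv> oscillatory_integral lebesgue (\<lambda>\<omega>. \<omega>)"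

lemma borel_measurable_lebesgue_ident: "(\<lambda>\<omega>::'a::euclidean_space. \<omega>) \<in> borel_measurable lebesgue"
  by (intro measurable_completion) simp

lemma char_integral_diff:
  assumes "integrable lebesgue f" "integrable lebesgue g"
  shows "char_integral (\<lambda>\<omega>. f \<omega> - g \<omega>) y = char_integral f y - char_integral g y"
  unfolding oscillatory_integral_def
  using assms[THEN integrable_oscillatory[OF _ borel_measurable_lebesgue_ident]]
  by (simp add: left_diff_distrib)

text \<open>The sup norm of \<open>char_integral\<close> is bounded by the L1 norm of the density,
  so decay at infinity survives L1 limits. This serves both the passage from compact to measurable
  sets and the limit step of the induction.\<close>

lemma char_integral_vanishes_approx:
  fixes f :: "'a::euclidean_space \<Rightarrow> complex"
  assumes f: "integrable lebesgue f"
    and approx: "\<And>e::real. e > 0 \<Longrightarrow> \<exists>g. integrable lebesgue g \<and> (\<integral>\<omega>. norm (f \<omega> - g \<omega>) \<partial>lebesgue) < e \<and>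
      (char_integral g \<longlongrightarrow> 0) at_infinity"
  shows "(char_integral f \<longlongrightarrow> 0) at_infinity"
proof (rule tendstoI)
  fix e :: real assume "e > 0"
  then obtain g where g: "integrable lebesgue g" "(\<integral>\<omega>. norm (f \<omega> - g \<omega>) \<partial>lebesgue) < e / 2"
      "(char_integral g \<longlongrightarrow> 0) at_infinity"
    using approx[of "e / 2"] by auto
  have "\<forall>\<^sub>F y in at_infinity. dist (char_integral g y) 0 < e / 2"
    using tendstoD[OF g(3), of "e / 2"] \<open>e > 0\<close> by simp
  thus "\<forall>\<^sub>F y in at_infinity. dist (char_integral f y) 0 < e"
  proof eventually_elim
    case (elim y)
    have "norm (char_integral f y - char_integral g y) < e / 2"
      using norm_oscillatory_integral_le[of lebesgue "\<lambda>\<omega>. \<omega>" "\<lambda>\<omega>. f \<omega> - g \<omega>" y] g(2)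
      by (simp add: char_integral_diff[OF f g(1)])
    thus ?case
      using elim norm_triangle_ineq[of "char_integral f y - char_integral g y" "char_integral g y"]
      by (simp add: dist_norm)
  qed
qed

lemma integral_lborel_translate:
  fixes g :: "'a::euclidean_space \<Rightarrow> 'b::{banach, second_countable_topology}"
  assumes "g \<in> borel_measurable borel"
  shows "(\<integral>\<omega>. g (h + \<omega>) \<partial>lborel) = (\<integral>\<omega>. g \<omega> \<partial>lborel)"
proof -
  have "(\<integral>\<omega>. g \<omega> \<partial>lborel) = (\<integral>\<omega>. g \<omega> \<partial>distr lborel borel ((+) h))"
    by (simp add: lborel_distr_plus)
  also have "\<dots> = (\<integral>\<omega>. g (h + \<omega>) \<partial>lborel)"
    by (rule integral_distr) (use assms in auto)
  finally show ?thesis by simp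
qed

lemma integrable_lborel_indicat_compact:
  fixes K :: "'a::euclidean_space set"
  assumes "compact K"
  shows "integrable lborel (indicat_real K)"
  using emeasure_compact_finite[OF assms] borel_compact[OF assms]
  by (simp add: integrable_indicator_iff)

lemma integrable_lborel_indicat_translate:
  fixes K :: "'a::euclidean_space set"
  assumes "compact K"
  shows "integrable lborel (\<lambda>\<omega>. indicat_real K (h + \<omega>))"
proof -
  have "(\<lambda>\<omega>. indicat_real K (h + \<omega>)) = indicat_real ((+) (- h) ` K)"
    by (force simp: indicator_def fun_eq_iff image_iff)
  thus ?thesis
    using integrable_lborel_indicat_compact[OF compact_translation[OF assms, of "- h"]] by simp
qed

text \<open>Off \<open>K\<close>, whose complement is open, the translated indicator is eventually
  0. On the boundary of \<open>K\<close> it need not converge, hence the restriction to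
  \<open>- K\<close>. The other half of the symmetric difference is recovered later from translation
  invariance.\<close>

lemma translation_overhang_tendsto_0:
  fixes K :: "'a::euclidean_space set"
  assumes K: "compact K"
  shows "((\<lambda>h. \<integral>\<omega>. indicat_real K (h + \<omega>) * indicat_real (- K) \<omega> \<partial>lborel) \<longlongrightarrow> 0) (at 0)"
  unfolding tendsto_at_iff_sequentially
proof (intro allI impI)
  fix h :: "nat \<Rightarrow> 'a" assume h: "h \<longlonglongrightarrow> 0"
  obtain B where B: "\<And>n. norm (h n) \<le> B"
    using convergent_imp_Bseq[OF convergentI[OF h]] by (auto simp: Bseq_def)
  obtain R where R: "\<And>x. x \<in> K \<Longrightarrow> norm x \<le> R"
    using compact_imp_bounded[OF K] by (auto simp: bounded_iff)
  have [measurable]: "K \<in> sets borel" using K by (rule borel_compact)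
  have "(\<lambda>n. \<integral>\<omega>. indicat_real K (h n + \<omega>) * indicat_real (- K) \<omega> \<partial>lborel)
      \<longlonglongrightarrow> (\<integral>\<omega>. 0 \<partial>(lborel :: 'a measure))"
  \<comment> \<open>Both \<open>K\<close> and the sequence of shifts are bounded, so one ball
    contains all the translates.\<close>
  proof (rule integral_dominated_convergence[where w = "indicat_real (cball 0 (R + B))"])
    show "integrable lborel (indicat_real (cball (0::'a) (R + B)))"
      by (rule integrable_lborel_indicat_compact) simp
    show "AE \<omega> in lborel. (\<lambda>n. indicat_real K (h n + \<omega>) * indicat_real (- K) \<omega>) \<longlonglongrightarrow> 0"
    proof (rule AE_I2)
      fix \<omega> show "(\<lambda>n. indicat_real K (h n + \<omega>) * indicat_real (- K) \<omega>) \<longlonglongrightarrow> 0"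
      proof (cases "\<omega> \<in> K")
        case False
        have "(\<lambda>n. h n + \<omega>) \<longlonglongrightarrow> \<omega>" using tendsto_add[OF h tendsto_const[of \<omega>]] by simp
        hence "\<forall>\<^sub>F n in sequentially. h n + \<omega> \<in> - K"
          by (rule topological_tendstoD) (use False K compact_imp_closed in auto)
        thus ?thesis
          by (intro tendsto_eventually) (auto elim!: eventually_mono)
      qed simp
    qed
    show "AE \<omega> in lborel. norm (indicat_real K (h n + \<omega>) * indicat_real (- K) \<omega>)
        \<le> indicat_real (cball 0 (R + B)) \<omega>" for n
    proof (rule AE_I2)
      fix \<omega>
      have "norm \<omega> \<le> R + B" if "h n + \<omega> \<in> K"
        using norm_triangle_ineq4[of "h n + \<omega>" "h n"] B[of n] R[OF that] by simp
      thus "norm (indicat_real K (h n + \<omega>) * indicat_real (- K) \<omega>) \<le> indicat_real (cball 0 (R + B)) \<omega>"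
        by (auto simp: indicator_def)
    qed
  qed measurable
  thus "((\<lambda>h. \<integral>\<omega>. indicat_real K (h + \<omega>) * indicat_real (- K) \<omega> \<partial>lborel) \<circ> h) \<longlonglongrightarrow> 0"
    by (simp add: o_def)
qed

text \<open>Translating by \<open>h = (\<pi> / \<parallel>y\<parallel>\<^sup>2) y\<close> flips the sign of the exponential factor.\<close>

lemma norm_char_integral_compact_le:
  fixes K :: "'a::euclidean_space set"
  assumes K: "compact K" and h: "h \<bullet> y = pi"
  shows "norm (char_integral (\<lambda>\<omega>. complex_of_real (indicat_real K \<omega>)) y) \<le>
    (\<integral>\<omega>. indicat_real K (h + \<omega>) * indicat_real (- K) \<omega> \<partial>lborel)"
proof -
  let ?e = "\<lambda>\<omega>. exp (\<i> * complex_of_real (\<omega> \<bullet> y))"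
  let ?k = "\<lambda>\<omega>. complex_of_real (indicat_real K \<omega>)"
  have [measurable]: "K \<in> sets borel" using K by (rule borel_compact)
  have [measurable]: "?e \<in> borel_measurable borel"
    by (intro borel_measurable_continuous_onI continuous_intros)
  note ints = integrable_lborel_indicat_compact[OF K] integrable_lborel_indicat_translate[OF K, of h]
  have int: "integrable lborel (\<lambda>\<omega>. ?k \<omega> * ?e \<omega>)" "integrable lborel (\<lambda>\<omega>. ?k (h + \<omega>) * ?e \<omega>)"
    using ints by (auto intro!: integrable_oscillatory)
  have "char_integral ?k y = (\<integral>\<omega>. ?k \<omega> * ?e \<omega> \<partial>lborel)" (is "?I = _")
    unfolding oscillatory_integral_def by (rule integral_completion) measurable
  moreover have "(\<integral>\<omega>. ?k \<omega> * ?e \<omega> \<partial>lborel) = (\<integral>\<omega>. ?k (h + \<omega>) * ?e (h + \<omega>) \<partial>lborel)"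
    by (rule integral_lborel_translate[symmetric]) measurable
  moreover have "?e (h + \<omega>) = - ?e \<omega>" for \<omega>
    by (simp add: inner_add_left h distrib_left exp_add)
  \<comment> \<open>Adding the original and the translated form of the integral turns the sign flip
    into a difference of indicators.\<close>
  ultimately have "2 * ?I = (\<integral>\<omega>. ?k \<omega> * ?e \<omega> - ?k (h + \<omega>) * ?e \<omega> \<partial>lborel)"
    using int by simp
  also have "\<dots> = (\<integral>\<omega>. (?k \<omega> - ?k (h + \<omega>)) * ?e \<omega> \<partial>lborel)"
    by (simp add: left_diff_distrib)
  finally have "norm (2 * ?I) = norm (\<integral>\<omega>. (?k \<omega> - ?k (h + \<omega>)) * ?e \<omega> \<partial>lborel)"
    by (rule arg_cong)
  also have "\<dots> \<le> (\<integral>\<omega>. norm ((?k \<omega> - ?k (h + \<omega>)) * ?e \<omega>) \<partial>lborel)"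
    by (rule integral_norm_bound)
  \<comment> \<open>For numbers \<open>a\<close>, \<open>b\<close> in {0, 1}, the distance of
    \<open>a\<close> and \<open>b\<close> is \<open>2 * b * (1 - a) + (a - b)\<close>. The last
    difference integrates to 0 by translation invariance, leaving the one-sided overhang.\<close>
  also have "\<dots> = (\<integral>\<omega>. 2 * (indicat_real K (h + \<omega>) * indicat_real (- K) \<omega>)
      + (indicat_real K \<omega> - indicat_real K (h + \<omega>)) \<partial>lborel)"
    by (intro Bochner_Integration.integral_cong) (auto simp: norm_mult indicator_def)
  also have "\<dots> = 2 * (\<integral>\<omega>. indicat_real K (h + \<omega>) * indicat_real (- K) \<omega> \<partial>lborel)"
  proof -
    have "integrable lborel (\<lambda>\<omega>. indicat_real K (h + \<omega>) * indicat_real (- K) \<omega>)"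
      by (rule Bochner_Integration.integrable_bound[OF ints(2)]) (auto simp: indicator_def)
    thus ?thesis
      using ints integral_lborel_translate[of "indicat_real K" h] by simp
  qed
  finally show ?thesis by (simp add: norm_mult)
qed

lemma char_integral_compact_vanishes:
  fixes K :: "'a::euclidean_space set"
  assumes K: "compact K"
  shows "(char_integral (\<lambda>\<omega>. complex_of_real (indicat_real K \<omega>)) \<longlongrightarrow> 0) at_infinity"
proof (rule Lim_null_comparison)
  \<comment> \<open>The shortest vector whose inner product with \<open>y\<close> is
    \<open>pi\<close>; its norm \<open>pi / norm y\<close> tends to 0. At \<open>y = 0\<close>
    division gives the zero vector, so that point is excluded.\<close>
  define h where "h y = (pi / (norm y)\<^sup>2) *\<^sub>R y" for y :: 'a
  have nz: "\<forall>\<^sub>F y::'a in at_infinity. y \<noteq> 0"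
    by (rule eventually_not_equal_at_infinity)
  show "\<forall>\<^sub>F y in at_infinity. norm (char_integral (\<lambda>\<omega>. complex_of_real (indicat_real K \<omega>)) y)
      \<le> (\<integral>\<omega>. indicat_real K (h y + \<omega>) * indicat_real (- K) \<omega> \<partial>lborel)"
    using nz
    by eventually_elim
      (auto intro!: norm_char_integral_compact_le[OF K] simp: h_def power2_norm_eq_inner)
  have "((\<lambda>y. pi * inverse (norm y)) \<longlongrightarrow> pi * 0) (at_infinity :: 'a filter)"
    by (intro tendsto_intros tendsto_inverse_0_at_top filterlim_norm_at_top)
  moreover have "norm (h y) = pi * inverse (norm y)" for y
    by (simp add: h_def power2_eq_square divide_simps)
  ultimately have "((\<lambda>y. norm (h y)) \<longlongrightarrow> 0) at_infinity"
    by (simp only: mult_zero_right)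
  hence "(h \<longlongrightarrow> 0) at_infinity"
    by (rule tendsto_norm_zero_cancel)
  hence "filterlim h (at 0) at_infinity"
    using nz by (auto simp: filterlim_at h_def elim!: eventually_mono)
  from filterlim_compose[OF translation_overhang_tendsto_0[OF K] this]
  show "((\<lambda>y. \<integral>\<omega>. indicat_real K (h y + \<omega>) * indicat_real (- K) \<omega> \<partial>lborel) \<longlongrightarrow> 0) at_infinity" .
qed

text \<open>Inner regularity supplies a closed set \<open>C\<close> at the cost of half of
  \<open>e\<close>. Its parts outside growing balls decrease to the empty set and have finite
  measure, so truncating \<open>C\<close> costs less than the other half.\<close>

lemma lmeasurable_approx_compact:
  fixes A :: "'a::euclidean_space set"
  assumes A: "A \<in> lmeasurable" and "e > 0"
  obtains K where "compact K" "K \<subseteq> A" "A - K \<in> lmeasurable" "measure lebesgue (A - K) < e"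
proof -
  obtain C where C: "closed C" "C \<subseteq> A" "A - C \<in> lmeasurable" "emeasure lebesgue (A - C) < ennreal (e / 2)"
    using sets_lebesgue_inner_closed[of A "e / 2"] A \<open>e > 0\<close> by (auto dest: fmeasurableD)
  define D where "D n = C - cball 0 (real n)" for n
  have CA: "C \<in> lmeasurable"
    using fmeasurableI2[OF A C(2)] borel_closed[OF C(1)] by simp
  have Dm: "D n \<in> lmeasurable" for n
    unfolding D_def using CA by (rule fmeasurable_Diff) auto
  have "(\<lambda>n. measure lebesgue (D n)) \<longlonglongrightarrow> measure lebesgue (\<Inter>n. D n)"
  proof (rule Lim_measure_decseq)
    show "range D \<subseteq> sets lebesgue" using Dm by auto
    show "decseq D" by (auto simp: decseq_def D_def)
    show "emeasure lebesgue (D n) \<noteq> \<infinity>" for n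
      using fmeasurableD2[OF Dm[of n]] unfolding infinity_ennreal_def .
  qed
  moreover have "(\<Inter>n. D n) = {}"
  proof -
    have "\<exists>n. x \<notin> D n" for x
      using real_arch_simple[of "norm x"] by (auto simp: D_def)
    thus ?thesis by auto
  qed
  ultimately have "(\<lambda>n. measure lebesgue (D n)) \<longlonglongrightarrow> 0" by simp
  hence "\<forall>\<^sub>F n in sequentially. measure lebesgue (D n) < e / 2"
    by (rule order_tendstoD) (use \<open>e > 0\<close> in auto)
  then obtain n where n: "measure lebesgue (D n) < e / 2"
    by (auto simp: eventually_sequentially)
  have eq: "A - C \<inter> cball 0 (real n) = (A - C) \<union> D n"
    using C(2) by (auto simp: D_def)
  show thesis
  proof
    show "compact (C \<inter> cball 0 (real n))" using C(1) by (simp add: closed_Int_compact)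
    show "C \<inter> cball 0 (real n) \<subseteq> A" using C(2) by auto
    show "A - C \<inter> cball 0 (real n) \<in> lmeasurable" unfolding eq using C(3) Dm by auto
    have "measure lebesgue (A - C) < e / 2"
      using C(3,4) \<open>e > 0\<close> by (simp add: emeasure_eq_measure2 ennreal_less_iff)
    thus "measure lebesgue (A - C \<inter> cball 0 (real n)) < e"
      unfolding eq using measure_Un_le[of "A - C" lebesgue "D n"] C(3) Dm[of n] n
      by (auto dest: fmeasurableD)
  qed
qed

theorem Riemann_Lebesgue:
  fixes f :: "'a::euclidean_space \<Rightarrow> complex"
  assumes "integrable lebesgue f"
  shows "(char_integral f \<longlongrightarrow> 0) at_infinity"
  using assms
proof (induction rule: integrable_induct)
  case (base A c)
  hence A: "A \<in> lmeasurable" by (simp add: fmeasurable_def)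
  have intA: "integrable lebesgue (\<lambda>\<omega>. complex_of_real (indicat_real A \<omega>))"
    using base by (intro integrable_of_real) (simp add: integrable_indicator_iff)
  have "(char_integral (\<lambda>\<omega>. complex_of_real (indicat_real A \<omega>)) \<longlongrightarrow> 0) at_infinity"
  proof (rule char_integral_vanishes_approx[OF intA])
    fix e :: real assume "e > 0"
    from lmeasurable_approx_compact[OF A this]
    obtain K where K: "compact K" "K \<subseteq> A" "A - K \<in> lmeasurable" "measure lebesgue (A - K) < e" .
    have "norm (complex_of_real (indicat_real A \<omega>) - complex_of_real (indicat_real K \<omega>)) =
        indicat_real (A - K) \<omega>" for \<omega>
      using K(2) by (auto simp: indicator_def)
    hence "(\<integral>\<omega>. norm (complex_of_real (indicat_real A \<omega>) - complex_of_real (indicat_real K \<omega>)) \<partial>lebesgue) < e"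
      using K(3,4) by simp
    moreover have "integrable lebesgue (\<lambda>\<omega>. complex_of_real (indicat_real K \<omega>))"
      using integrable_lborel_indicat_compact[OF K(1)]
      by (intro integrable_of_real) (simp add: integrable_completion)
    ultimately show "\<exists>g. integrable lebesgue g \<and>
        (\<integral>\<omega>. norm (complex_of_real (indicat_real A \<omega>) - g \<omega>) \<partial>lebesgue) < e \<and>
        (char_integral g \<longlongrightarrow> 0) at_infinity"
      using char_integral_compact_vanishes[OF K(1)] by blast
  qed
  hence "((\<lambda>y. c * char_integral (\<lambda>\<omega>. complex_of_real (indicat_real A \<omega>)) y) \<longlongrightarrow> 0) at_infinity"
    by (rule tendsto_mult_right_zero)
  moreover have "char_integral (\<lambda>\<omega>. indicator A \<omega> *\<^sub>R c) y =
      c * char_integral (\<lambda>\<omega>. complex_of_real (indicat_real A \<omega>)) y" for y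
    unfolding oscillatory_integral_def
    by (subst integral_mult_right_zero[symmetric]) (simp add: scaleR_conv_of_real mult_ac)
  ultimately show ?case by simp
next
  case (add f g)
  have "char_integral (\<lambda>\<omega>. f \<omega> + g \<omega>) y = char_integral f y + char_integral g y" for y
    unfolding oscillatory_integral_def
    using add(1,2)[THEN integrable_oscillatory[OF _ borel_measurable_lebesgue_ident]]
    by (simp add: distrib_right)
  thus ?case using tendsto_add[OF add(3,4)] by simp
next
  case (lim f s)
  show ?case
  proof (rule char_integral_vanishes_approx[OF \<open>integrable lebesgue f\<close>])
    fix e :: real assume "e > 0"
    have "(\<lambda>i. \<integral>\<omega>. norm (f \<omega> - s i \<omega>) \<partial>lebesgue) \<longlonglongrightarrow> (\<integral>\<omega>. 0 \<partial>(lebesgue :: 'a measure))"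
    \<comment> \<open>The approximants of the induction rule satisfy
      \<open>norm (s i \<omega>) \<le> 2 * norm (f \<omega>)\<close>; the triangle inequality adds
      one more.\<close>
    proof (rule integral_dominated_convergence[where w = "\<lambda>\<omega>. 3 * norm (f \<omega>)"])
      show "AE \<omega> in lebesgue. (\<lambda>i. norm (f \<omega> - s i \<omega>)) \<longlonglongrightarrow> 0"
        using lim by (intro AE_I2) (auto intro!: tendsto_eq_intros)
      show "AE \<omega> in lebesgue. norm (norm (f \<omega> - s i \<omega>)) \<le> 3 * norm (f \<omega>)" for i
      proof (rule AE_I2)
        fix \<omega> :: 'a
        have "norm (s i \<omega>) \<le> 2 * norm (f \<omega>)" using lim by simp
        thus "norm (norm (f \<omega> - s i \<omega>)) \<le> 3 * norm (f \<omega>)"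
          using norm_triangle_ineq4[of "f \<omega>" "s i \<omega>"] by simp
      qed
    qed (use lim in \<open>auto intro!: borel_measurable_integrable\<close>)
    hence "\<forall>\<^sub>F i in sequentially. (\<integral>\<omega>. norm (f \<omega> - s i \<omega>) \<partial>lebesgue) < e"
      using \<open>e > 0\<close> by (intro order_tendstoD) auto
    then obtain i where "(\<integral>\<omega>. norm (f \<omega> - s i \<omega>) \<partial>lebesgue) < e"
      by (auto simp: eventually_sequentially)
    thus "\<exists>g. integrable lebesgue g \<and> (\<integral>\<omega>. norm (f \<omega> - g \<omega>) \<partial>lebesgue) < e \<and>
        (char_integral g \<longlongrightarrow> 0) at_infinity"
      using lim by blast
  qed
qed

section \<open>Traces along \<open>T\<close> and the solution of the equation\<close>

lemma oscillatory_integral_trace: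
  fixes T :: "real^'m^'n"
  shows "oscillatory_integral M ((*v) (transpose T)) H x = oscillatory_integral M (\<lambda>\<omega>. \<omega>) H (T *v x)"
  by (simp add: oscillatory_integral_def dot_lmul_matrix)

lemma filterlim_matrix_at_infinity:
  fixes T :: "real^'m^'n"
  assumes "rank T = CARD('m)"
  shows "filterlim ((*v) T) at_infinity at_infinity"
proof -
  \<comment> \<open>An injective linear map in finite dimension is bounded below.\<close>
  obtain B where B: "B > 0" "\<And>x. B * norm x \<le> norm (T *v x)"
    using linear_inj_bounded_below_pos[OF matrix_vector_mul_linear[of T]] assms
    by (auto simp: full_rank_injective)
  have "filterlim (\<lambda>x::real^'m. B * norm x) at_top at_infinity"
    by (rule filterlim_tendsto_pos_mult_at_top[OF tendsto_const B(1) filterlim_norm_at_top])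
  hence "filterlim (\<lambda>x. norm (T *v x)) at_top at_infinity"
    by (rule filterlim_at_top_mono) (use B(2) in auto)
  thus ?thesis
    by (rule filterlim_norm_at_top_imp_at_infinity)
qed

text \<open>The kernel of the transposed matrix is orthogonal to every column of \<open>T\<close>.
  One nonzero column already confines it to a hyperplane. For \<open>\<mu> = 0\<close> this removes
  the frequencies at which the kernel divides by zero.\<close>

lemma AE_transpose_nonzero:
  fixes T :: "real^'m^'n"
  assumes "rank T = CARD('m)"
  shows "AE \<omega> in lebesgue. transpose T *v \<omega> \<noteq> 0"
proof -
  fix i :: 'm
  have "inj ((*v) T)" using assms by (simp add: full_rank_injective)
  hence "T *v axis i 1 \<noteq> 0"
    by (metis axis_eq_0_iff injD matrix_vector_mult_0_right zero_neq_one)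
  hence "negligible {\<omega>. (T *v axis i 1) \<bullet> \<omega> = 0}"
    by (intro negligible_hyperplane) auto
  moreover have "{\<omega>. transpose T *v \<omega> = 0} \<subseteq> {\<omega>. (T *v axis i 1) \<bullet> \<omega> = 0}"
  proof safe
    fix \<omega> assume "transpose T *v \<omega> = 0"
    hence "(transpose T *v \<omega>) \<bullet> axis i 1 = 0" by simp
    thus "(T *v axis i 1) \<bullet> \<omega> = 0"
      by (metis dot_lmul_matrix inner_commute transpose_matrix_vector)
  qed
  ultimately have "{\<omega>. transpose T *v \<omega> = 0} \<in> null_sets lebesgue"
    using negligible_subset negligible_iff_null_sets by blast
  from AE_not_in[OF this] show ?thesis by simp
qed

text \<open>Positive \<open>\<mu>\<close> and the limit case are treated together: they differ only
  in how the integrability \<open>int\<close> is obtained.\<close>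

lemma fourier_solution_trace:
  fixes T :: "real^'m^'n"
  assumes rank: "rank T = CARD('m)"
    and F: "integrable_fourier_transform F Fhat"
    and f: "\<And>x. f x = F (T *v x)"
    and \<mu>: "\<mu> \<ge> 0"
    and int: "integrable lebesgue
      (\<lambda>\<omega>. complex_of_real (1 / ((norm (transpose T *v \<omega>))\<^sup>2 + \<mu>)) * Fhat \<omega>)"
  shows "\<exists>u. (\<forall>x. complex_of_real (u x) = fourier_solution T \<mu> Fhat (T *v x)) \<and>
    vanishing_classical_solution \<mu> f u \<and>
    (\<forall>v. vanishing_classical_solution \<mu> f v \<longrightarrow> v = u)"
proof -
  define S where "S = (*v) (transpose T)"
  define c where "c = (1 / sqrt (2 * pi)) ^ CARD('n)"
  define H where "H \<omega> = complex_of_real c *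
    (complex_of_real (1 / ((norm (S \<omega>))\<^sup>2 + \<mu>)) * Fhat \<omega>)" for \<omega>
  \<comment> \<open>Reconciles the normalization in \<open>integrable_fourier_transform\<close> with
    that in \<open>fourier_solution\<close>.\<close>
  have c_eq: "(2 * pi) powr (- (real CARD('n) / 2)) = c"
  proof -
    have "(2 * pi) powr (- (real CARD('n) / 2)) = ((2 * pi) powr (- (1 / 2))) powr real CARD('n)"
      by (simp add: powr_powr)
    also have "(2 * pi) powr (- (1 / 2)) = 1 / sqrt (2 * pi)"
      using pi_gt_zero by (simp add: powr_minus_divide powr_half_sqrt del: pi_gt_zero)
    finally show ?thesis
      using pi_gt_zero by (simp add: powr_realpow c_def del: pi_gt_zero)
  qed
  have intF: "integrable lebesgue Fhat" using F by (simp add: integrable_fourier_transform_def)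
  have S: "S \<in> borel_measurable lebesgue"
    unfolding S_def
    by (intro measurable_completion)
      (auto intro!: borel_measurable_continuous_onI matrix_vector_mult_linear_continuous_on)
  have H: "integrable lebesgue H"
    using integrable_mult_right[OF int, of "complex_of_real c"] by (simp only: H_def[abs_def] S_def)
  have [measurable]: "Fhat \<in> borel_measurable lebesgue" "S \<in> borel_measurable lebesgue"
      "H \<in> borel_measurable lebesgue"
    using intF S H by (auto simp only: borel_measurable_integrable)
  have H2: "integrable lebesgue (\<lambda>\<omega>. complex_of_real ((norm (S \<omega>))\<^sup>2) * H \<omega>)"
  proof (rule Bochner_Integration.integrable_bound[OF integrable_mult_right[OF intF, of "complex_of_real c"]])
    show "AE \<omega> in lebesgue. norm (complex_of_real ((norm (S \<omega>))\<^sup>2) * H \<omega>)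
        \<le> norm (complex_of_real c * Fhat \<omega>)"
    proof (rule AE_I2)
      fix \<omega>
      have "(norm (S \<omega>))\<^sup>2 * \<bar>1 / ((norm (S \<omega>))\<^sup>2 + \<mu>)\<bar> \<le> 1"
        using \<mu> by (cases "(norm (S \<omega>))\<^sup>2 + \<mu> = 0") (simp_all add: divide_le_eq_1 less_le)
      from mult_right_mono[OF this, of "\<bar>c\<bar> * norm (Fhat \<omega>)"]
      show "norm (complex_of_real ((norm (S \<omega>))\<^sup>2) * H \<omega>) \<le> norm (complex_of_real c * Fhat \<omega>)"
        unfolding H_def norm_mult norm_of_real by (simp add: mult_ac)
    qed
  qed measurable
  define U where "U = oscillatory_integral lebesgue S H"
  have U: "U x = fourier_solution T \<mu> Fhat (T *v x)" for x
  proof -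
    have "U x = char_integral H (T *v x)"
      unfolding U_def S_def by (rule oscillatory_integral_trace)
    thus ?thesis
      unfolding oscillatory_integral_def fourier_solution_def H_def c_def S_def
      by (subst integral_mult_right_zero[symmetric]) (simp add: mult.assoc)
  qed
  have eqU: "oscillatory_integral lebesgue S (\<lambda>\<omega>. complex_of_real ((norm (S \<omega>))\<^sup>2) * H \<omega>) x
      + complex_of_real \<mu> * U x = complex_of_real (f x)" for x
  proof -
    let ?e = "\<lambda>\<omega>. exp (\<i> * complex_of_real (S \<omega> \<bullet> x))"
    have "oscillatory_integral lebesgue S (\<lambda>\<omega>. complex_of_real ((norm (S \<omega>))\<^sup>2) * H \<omega>) x
        + complex_of_real \<mu> * U x =
      (\<integral>\<omega>. complex_of_real ((norm (S \<omega>))\<^sup>2) * H \<omega> * ?e \<omega> + complex_of_real \<mu> * (H \<omega> * ?e \<omega>) \<partial>lebesgue)"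
      unfolding U_def oscillatory_integral_def
      using integrable_oscillatory[OF H S, of x] integrable_oscillatory[OF H2 S, of x] by simp
    \<comment> \<open>The symbol \<open>(norm (S \<omega>))^2 + \<mu>\<close> of the operator
      cancels its reciprocal in \<open>H\<close> wherever it is positive, that is, almost
      everywhere.\<close>
    also have "\<dots> = (\<integral>\<omega>. complex_of_real c * (Fhat \<omega> * ?e \<omega>) \<partial>lebesgue)"
    proof (rule integral_cong_AE)
      have [measurable]: "exp \<in> borel_measurable (borel :: complex measure)"
        by (intro borel_measurable_continuous_onI continuous_intros)
      show "(\<lambda>\<omega>. complex_of_real ((norm (S \<omega>))\<^sup>2) * H \<omega> * ?e \<omega> + complex_of_real \<mu> * (H \<omega> * ?e \<omega>))
          \<in> borel_measurable lebesgue" by measurable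
      show "(\<lambda>\<omega>. complex_of_real c * (Fhat \<omega> * ?e \<omega>)) \<in> borel_measurable lebesgue" by measurable
      show "AE \<omega> in lebesgue. complex_of_real ((norm (S \<omega>))\<^sup>2) * H \<omega> * ?e \<omega>
          + complex_of_real \<mu> * (H \<omega> * ?e \<omega>) = complex_of_real c * (Fhat \<omega> * ?e \<omega>)"
        using AE_transpose_nonzero[OF rank]
      proof eventually_elim
        case (elim \<omega>)
        let ?d = "(norm (S \<omega>))\<^sup>2 + \<mu>"
        have "?d > 0" using elim \<mu> by (simp add: S_def add_pos_nonneg)
        hence "complex_of_real ?d * complex_of_real (1 / ?d) = 1"
          by (subst of_real_mult[symmetric]) simp
        moreover have "complex_of_real ((norm (S \<omega>))\<^sup>2) * H \<omega> * ?e \<omega> + complex_of_real \<mu> * (H \<omega> * ?e \<omega>)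
          = (complex_of_real ?d * complex_of_real (1 / ?d)) * (complex_of_real c * (Fhat \<omega> * ?e \<omega>))"
          unfolding H_def of_real_add by (simp only: distrib_left distrib_right mult_ac)
        ultimately show ?case by simp
      qed
    qed
    also have "\<dots> = complex_of_real c * char_integral Fhat (T *v x)"
      unfolding oscillatory_integral_trace[symmetric] by (simp add: oscillatory_integral_def S_def)
    also have "\<dots> = complex_of_real (f x)"
      using F by (simp add: integrable_fourier_transform_def oscillatory_integral_def c_eq f)
    finally show ?thesis .
  qed
  have "(U \<longlongrightarrow> 0) at_infinity"
    unfolding U_def S_def oscillatory_integral_trace
    by (rule filterlim_compose[OF Riemann_Lebesgue[OF H] filterlim_matrix_at_infinity[OF rank]])
  hence sol: "vanishing_classical_solution \<mu> (\<lambda>x. L (complex_of_real (f x))) (\<lambda>x. L (U x))"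
    if L: "bounded_linear L" for L
  proof -
    interpret bounded_linear L by fact
    have "L (complex_of_real \<mu> * z) = \<mu> * L z" for z
      using scaleR[of \<mu> z] by (simp add: scaleR_conv_of_real)
    hence "- laplacian (\<lambda>x. L (U x)) x + \<mu> * L (U x) = L (complex_of_real (f x))" for x
      unfolding U_def oscillatory_integral_C2(2)[OF H S H2 L] eqU[symmetric]
      by (simp add: add)
    moreover have "((\<lambda>x. L (U x)) \<longlongrightarrow> 0) at_infinity"
      using tendsto[OF \<open>(U \<longlongrightarrow> 0) at_infinity\<close>] by (simp add: zero)
    ultimately show ?thesis
      unfolding vanishing_classical_solution_def
      using oscillatory_integral_C2(1)[OF H S H2 L] by (simp add: U_def)
  qed
  have Re: "vanishing_classical_solution \<mu> f (\<lambda>x. Re (U x))"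
    using sol[OF bounded_linear_Re] by simp
  \<comment> \<open>The zero functional supplies the zero solution with which the imaginary part is
    compared; both have datum 0 because \<open>f\<close> is real.\<close>
  have "(\<lambda>x. Im (U x)) = (\<lambda>x. 0)"
    using vanishing_classical_solution_unique[OF \<mu> sol[OF bounded_linear_zero] sol[OF bounded_linear_Im, simplified]]
    by simp
  hence real: "complex_of_real (Re (U x)) = U x" for x
    by (metis complex_is_Real_iff of_real_Re)
  show ?thesis
  proof (intro exI conjI allI impI)
    show "complex_of_real (Re (U x)) = fourier_solution T \<mu> Fhat (T *v x)" for x
      using real[of x] U[of x] by (rule trans)
    show "vanishing_classical_solution \<mu> f (\<lambda>x. Re (U x))" by (rule Re)
    show "v = (\<lambda>x. Re (U x))" if "vanishing_classical_solution \<mu> f v" for v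
      using \<mu> Re that by (rule vanishing_classical_solution_unique)
  qed
qed

theorem theorem2p1:
  fixes T :: "real^'m^'n"
    and F :: "real^'n \<Rightarrow> real"
    and Fhat :: "real^'n \<Rightarrow> complex"
    and f :: "real^'m \<Rightarrow> real"
  assumes "CARD('m) < CARD('n)"
    and "rank T = CARD('m)"
    and "integrable_fourier_transform F Fhat"
    and "\<And>x. f x = F (T *v x)"
  shows "(\<forall>\<mu>>0. \<exists>u.
            (\<forall>x. complex_of_real (u x) = fourier_solution T \<mu> Fhat (T *v x)) \<and>
            vanishing_classical_solution \<mu> f u \<and>
            (\<forall>v. vanishing_classical_solution \<mu> f v \<longrightarrow> v = u)) \<and>
         (integrable lebesgue
              (\<lambda>\<omega>. complex_of_real (1 / (norm (transpose T *v \<omega>))\<^sup>2) * Fhat \<omega>) \<longrightarrow>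
          (\<exists>u.
            (\<forall>x. complex_of_real (u x) = fourier_solution T 0 Fhat (T *v x)) \<and>
            vanishing_classical_solution 0 f u \<and>
            (\<forall>v. vanishing_classical_solution 0 f v \<longrightarrow> v = u)))"
proof (intro conjI allI impI)
  let ?k = "\<lambda>\<mu> \<omega>. complex_of_real (1 / ((norm (transpose T *v \<omega>))\<^sup>2 + \<mu>)) * Fhat \<omega>"
  have Fhat: "integrable lebesgue Fhat"
    using assms(3) by (simp add: integrable_fourier_transform_def)
  fix \<mu> :: real assume "\<mu> > 0"
  \<comment> \<open>For positive \<open>\<mu>\<close> the multiplier is bounded by
    \<open>1 / \<mu>\<close>, so integrability of \<open>Fhat\<close> suffices.\<close>
  have "integrable lebesgue (?k \<mu>)"
  proof (rule Bochner_Integration.integrable_bound[OF integrable_mult_right[OF Fhat, of "complex_of_real (1 / \<mu>)"]])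
    have [measurable]: "Fhat \<in> borel_measurable lebesgue" using Fhat by auto
    have [measurable]: "(*v) (transpose T) \<in> borel_measurable lebesgue"
      by (intro measurable_completion)
        (auto intro!: borel_measurable_continuous_onI matrix_vector_mult_linear_continuous_on)
    show "?k \<mu> \<in> borel_measurable lebesgue" by measurable
    have "\<bar>1 / ((norm (transpose T *v \<omega>))\<^sup>2 + \<mu>)\<bar> \<le> \<bar>1 / \<mu>\<bar>" for \<omega>
      using \<open>\<mu> > 0\<close> by (simp add: add_nonneg_pos frac_le)
    from mult_right_mono[OF this norm_ge_zero[of "Fhat _"]]
    show "AE \<omega> in lebesgue. norm (?k \<mu> \<omega>) \<le> norm (complex_of_real (1 / \<mu>) * Fhat \<omega>)"
      unfolding norm_mult norm_of_real by simp
  qed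
  with \<open>\<mu> > 0\<close> show "\<exists>u. (\<forall>x. complex_of_real (u x) = fourier_solution T \<mu> Fhat (T *v x)) \<and>
      vanishing_classical_solution \<mu> f u \<and>
      (\<forall>v. vanishing_classical_solution \<mu> f v \<longrightarrow> v = u)"
    by (intro fourier_solution_trace[OF assms(2,3,4)]) auto
next
  assume "integrable lebesgue
    (\<lambda>\<omega>. complex_of_real (1 / (norm (transpose T *v \<omega>))\<^sup>2) * Fhat \<omega>)"
  thus "\<exists>u. (\<forall>x. complex_of_real (u x) = fourier_solution T 0 Fhat (T *v x)) \<and>
      vanishing_classical_solution 0 f u \<and>
      (\<forall>v. vanishing_classical_solution 0 f v \<longrightarrow> v = u)"
    by (intro fourier_solution_trace[OF assms(2,3,4)]) auto
qed

end
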